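(* Let $k,\ell$ be positive integers with $(k,\ell)\neq(2,1)$. For each $i\in[k]=\{0,1,\ldots,k-1\}$, let $S_i^k$ be the set of vertices $v=v_0v_1\cdots v_{k\ell-1}$ of $ST^\ell_k$ whose first entry is $v_0=i$. Then $S_i^k$ is an E$^\ell$-set of $ST^\ell_k$, and each D$^\ell$-set with respect to $S_i^k$ is an independent set of $ST^\ell_k$.
   Context: For integers $k\ge 1$, $\ell\ge 1$, the multiset star transposition graph $ST^\ell_k$ has as vertices all strings $v_0v_1\cdots v_{k\ell-1}$ of length $k\ell$ over the alphabet $[k]=\{0,\ldots,k-1\}$ in which each symbol occurs exactly $\ell$ times; two vertices $v,w$ are adjacent iff $w$ is obtained from $v$ by swapping the entries $v_0$ and $v_j$ for some $j\in\{1,\ldots,k\ell-1\}$ with $v_j\neq v_0$. For a graph $G$ and $S\subseteq V(G)$, $S$ is an E$^\ell$-set (efficient dominating$^\ell$-set) if for each $v\in V(G)\setminus S$ there are exactly $\ell$ vertices $v^0,\ldots,v^{\ell-1}\in S$ adjacent to $v$, and, when $\ell>1$, $v$ is the only vertex of $G$ adjacent to all of $v^0,\ldots,v^{\ell-1}$. The set $S(v)=\{v^0,\ldots,v^{\ell-1}\}$ is called the D$^\ell$-set of $v$ with respect to $S$. *)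

theory Defs
  imports "Graph_Theory.Pair_Digraph"
begin

definition swap_first :: "nat \<Rightarrow> 'a list \<Rightarrow> 'a list" where
  "swap_first j v = v[0 := v ! j, j := v ! 0]"

definition multiset_strings :: "nat \<Rightarrow> nat \<Rightarrow> nat list set" where
  "multiset_strings l k =
     {v. length v = k * l \<and> set v \<subseteq> {..<k} \<and> (\<forall>a<k. count_list v a = l)}"

text \<open>A simple graph is represented as a symmetric loop-free digraph, with each edge
  present as two opposite arcs; see \<open>pair_graph_ST\<close> below.\<close>

definition ST :: "nat \<Rightarrow> nat \<Rightarrow> nat list pair_pre_digraph" where
  "ST l k =
     \<lparr> pverts = multiset_strings l k,
       parcs = {(v, w). v \<in> multiset_strings l k \<and> w \<in> multiset_strings l k \<and>
                  (\<exists>j\<in>{1..<k * l}. v ! j \<noteq> v ! 0 \<and> w = swap_first j v)} \<rparr>"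

definition D_set :: "'a pair_pre_digraph \<Rightarrow> 'a set \<Rightarrow> 'a \<Rightarrow> 'a set" where
  "D_set G S v = {u \<in> S. (v, u) \<in> parcs G}"

text \<open>Intended for \<open>l \<ge> 1\<close>, where \<open>card (D_set G S v) = l\<close> forces finiteness.
  That \<open>v\<close> itself is adjacent to all of \<open>D_set G S v\<close> holds by definition, so only
  uniqueness is stated.\<close>

definition E_set :: "nat \<Rightarrow> 'a pair_pre_digraph \<Rightarrow> 'a set \<Rightarrow> bool" where
  "E_set l G S \<longleftrightarrow> S \<subseteq> pverts G \<and>
     (\<forall>v\<in>pverts G - S. card (D_set G S v) = l \<and>
        (l > 1 \<longrightarrow> (\<forall>w\<in>pverts G. (\<forall>u\<in>D_set G S v. (w, u) \<in> parcs G) \<longrightarrow> w = v)))"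

definition independent_set :: "'a pair_pre_digraph \<Rightarrow> 'a set \<Rightarrow> bool" where
  "independent_set G A \<longleftrightarrow> A \<subseteq> pverts G \<and> (\<forall>u\<in>A. \<forall>w\<in>A. (u, w) \<notin> parcs G)"

definition first_entry_set :: "nat \<Rightarrow> nat \<Rightarrow> nat \<Rightarrow> nat list set" where
  "first_entry_set l k i = {v \<in> pverts (ST l k). v ! 0 = i}"

lemma swap_first_swap_first:
  assumes "j < length v"
  shows "swap_first j (swap_first j v) = v"
proof (rule nth_equalityI)
  fix n assume "n < length (swap_first j (swap_first j v))"
  then show "swap_first j (swap_first j v) ! n = v ! n"
    using assms order.strict_trans1[OF le0 assms]
    by (simp add: swap_first_def nth_list_update)
qed (simp add: swap_first_def)

lemma mset_swap_first:
  assumes "j < length v"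
  shows "mset (swap_first j v) = mset v"
  unfolding swap_first_def using assms by (intro mset_swap) auto

lemma swap_first_in_multiset_strings:
  assumes "v \<in> multiset_strings l k" "j < k * l"
  shows "swap_first j v \<in> multiset_strings l k"
proof -
  have m: "mset (swap_first j v) = mset v"
    using assms by (intro mset_swap_first) (simp add: multiset_strings_def)
  have "length (swap_first j v) = length v" "set (swap_first j v) = set v"
    using mset_eq_length[OF m] mset_eq_setD[OF m] by simp_all
  moreover have "count_list (swap_first j v) a = count_list v a" for a
    using arg_cong[OF m, of "\<lambda>M. count M a"] by (simp add: count_mset)
  ultimately show ?thesis using assms(1) by (simp add: multiset_strings_def)
qed

lemma finite_multiset_strings: "finite (multiset_strings l k)"
  by (rule finite_subset[OF _ finite_lists_length_eq[of "{..<k}" "k * l"]])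
    (auto simp: multiset_strings_def)

lemma pair_graph_ST: "pair_graph (ST l k)"
proof
  show "finite (pverts (ST l k))"
    by (simp add: ST_def finite_multiset_strings)
  show "finite (parcs (ST l k))"
    by (rule finite_subset[of _ "multiset_strings l k \<times> multiset_strings l k"])
      (auto simp: ST_def finite_multiset_strings)
  show "fst e \<noteq> snd e" if "e \<in> parcs (ST l k)" for e
  proof -
    from that obtain j where j: "fst e \<in> multiset_strings l k" "1 \<le> j" "j < k * l"
      "fst e ! j \<noteq> fst e ! 0" "snd e = swap_first j (fst e)"
      by (auto simp: ST_def)
    then have "snd e ! j = fst e ! 0"
      by (simp add: swap_first_def multiset_strings_def)
    with j show ?thesis by metis
  qed
  have "(w, v) \<in> parcs (ST l k)" if vw: "(v, w) \<in> parcs (ST l k)" for v w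
  proof -
    from vw obtain j where j: "v \<in> multiset_strings l k" "w \<in> multiset_strings l k"
      "1 \<le> j" "j < k * l" "v ! j \<noteq> v ! 0" "w = swap_first j v"
      by (auto simp: ST_def)
    then have len: "j < length v" by (simp add: multiset_strings_def)
    then have "0 < length v" by linarith
    with len have "w ! j \<noteq> w ! 0" using j by (simp add: swap_first_def nth_list_update)
    moreover have "v = swap_first j w" unfolding j(6) using len by (simp add: swap_first_swap_first)
    ultimately have "\<exists>j\<in>{1..<k * l}. w ! j \<noteq> w ! 0 \<and> v = swap_first j w"
      using j(3,4) by (intro bexI[of _ j] conjI) simp_all
    then show ?thesis using j(1,2) by (simp add: ST_def)
  qed
  then show "symmetric (with_proj (ST l k))"
    by (auto simp: symmetric_def sym_def)
qed (auto simp: ST_def)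

end

theory Submission
  imports Defs
begin

text \<open>A vertex \<open>v\<close> with \<open>v ! 0 \<noteq> i\<close> has one neighbour starting with \<open>i\<close> for each of the \<open>l\<close>
  positions of \<open>i\<close> in \<open>v\<close>. Adjacent vertices have different first entries, so these neighbours
  are pairwise non-adjacent. Let \<open>w\<close> be adjacent to the neighbours obtained from two distinct
  positions \<open>j\<close> and \<open>m\<close>. The neighbour from \<open>m\<close> has entry \<open>i\<close> both at \<open>0\<close> and at \<open>j\<close>, so
  \<open>w ! j = i\<close> whichever swap leads to \<open>w\<close>. The neighbour from \<open>j\<close> has entry \<open>v ! 0 \<noteq> i\<close> at \<open>j\<close>,
  so the swap leading from it to \<open>w\<close> must involve \<open>j\<close>, and this swap gives back \<open>v\<close>.\<close>

definition positions :: "'a \<Rightarrow> 'a list \<Rightarrow> nat set" where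
  "positions a v = {j. j < length v \<and> v ! j = a}"

lemma card_positions: "card (positions a v) = count_list v a"
  by (simp add: positions_def count_list_eq_length_filter length_filter_conv_card eq_commute)

lemma nth_swap_first:
  assumes "j < length v" "n < length v"
  shows "swap_first j v ! n = (if n = j then v ! 0 else if n = 0 then v ! j else v ! n)"
  using assms by (auto simp: swap_first_def nth_list_update)

lemma nth_0_swap_first: "j < length v \<Longrightarrow> swap_first j v ! 0 = v ! j"
  by (subst nth_swap_first) auto

lemma length_swap_first [simp]: "length (swap_first j v) = length v"
  by (simp add: swap_first_def)

lemma inj_on_swap_first: "inj_on (\<lambda>j. swap_first j v) {j. j < length v \<and> v ! j \<noteq> v ! 0}"
proof (rule inj_onI, rule ccontr)
  fix j m
  assume j: "j \<in> {j. j < length v \<and> v ! j \<noteq> v ! 0}"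
    and m: "m \<in> {j. j < length v \<and> v ! j \<noteq> v ! 0}"
    and swap_eq: "swap_first j v = swap_first m v" and "j \<noteq> m"
  have "j \<noteq> 0" using j by (intro notI) simp
  then have "swap_first j v ! j = v ! 0" "swap_first m v ! j = v ! j"
    using j m \<open>j \<noteq> m\<close> by (simp_all add: nth_swap_first)
  with swap_eq j show False by simp
qed

lemma swap_first_swap_first_eqD:
  assumes swap_eq: "swap_first p (swap_first j v) = swap_first q (swap_first m v)"
    and bounds: "p < length v" "j < length v" "q < length v" "m < length v"
    and "j \<noteq> m" and jm: "v ! j = v ! m" and "v ! j \<noteq> v ! 0"
  shows "p = j"
proof (rule ccontr)
  assume "p \<noteq> j"
  have "0 < length v" using bounds by linarith
  have "j \<noteq> 0" using \<open>v ! j \<noteq> v ! 0\<close> by (intro notI) simp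
  have "v ! 0 = swap_first p (swap_first j v) ! j"
    using bounds \<open>j \<noteq> 0\<close> \<open>p \<noteq> j\<close> by (simp add: nth_swap_first)
  also have "\<dots> = swap_first q (swap_first m v) ! j"
    by (simp only: swap_eq)
  also have "\<dots> = v ! j"
    using bounds \<open>0 < length v\<close> \<open>j \<noteq> 0\<close> \<open>j \<noteq> m\<close> jm by (auto simp: nth_swap_first)
  finally show False using \<open>v ! j \<noteq> v ! 0\<close> by simp
qed

lemma D_set_subset: "D_set G S v \<subseteq> S"
  by (auto simp: D_set_def)

lemma independent_set_subset: "independent_set G A \<Longrightarrow> B \<subseteq> A \<Longrightarrow> independent_set G B"
  by (auto simp: independent_set_def)

lemma E_setI:
  assumes "S \<subseteq> pverts G"
    and card_D: "\<And>v. v \<in> pverts G - S \<Longrightarrow> card (D_set G S v) = l"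
    and common_unique: "\<And>u u' v w. u \<in> S \<Longrightarrow> u' \<in> S \<Longrightarrow> u \<noteq> u' \<Longrightarrow>
      (v, u) \<in> parcs G \<Longrightarrow> (v, u') \<in> parcs G \<Longrightarrow>
      (w, u) \<in> parcs G \<Longrightarrow> (w, u') \<in> parcs G \<Longrightarrow> w = v"
  shows "E_set l G S"
  unfolding E_set_def
proof (intro conjI ballI impI)
  fix v w
  assume v: "v \<in> pverts G - S" and "l > 1" and w: "\<forall>u\<in>D_set G S v. (w, u) \<in> parcs G"
  have "\<not> card (D_set G S v) \<le> Suc 0" using card_D[OF v] \<open>l > 1\<close> by simp
  moreover from this have "finite (D_set G S v)" by (intro card_ge_0_finite) simp
  ultimately obtain u u' where "u \<in> D_set G S v" "u' \<in> D_set G S v" "u \<noteq> u'"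
    by (auto simp: card_le_Suc0_iff_eq)
  with w show "w = v" by (intro common_unique[of u u' v w]) (auto simp: D_set_def)
qed (use assms in auto)

lemma pverts_ST: "pverts (ST l k) = multiset_strings l k"
  by (simp add: ST_def)

lemma length_multiset_strings: "v \<in> multiset_strings l k \<Longrightarrow> length v = k * l"
  by (simp add: multiset_strings_def)

lemma parcs_ST_iff:
  "(v, w) \<in> parcs (ST l k) \<longleftrightarrow>
     v \<in> multiset_strings l k \<and> (\<exists>j<length v. v ! j \<noteq> v ! 0 \<and> w = swap_first j v)"
proof -
  have "(\<exists>j\<in>{1..<n}. v ! j \<noteq> v ! 0 \<and> P j) \<longleftrightarrow> (\<exists>j<n. v ! j \<noteq> v ! 0 \<and> P j)" for n P
    by (metis One_nat_def Suc_leI atLeastLessThan_iff gr0I)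
  then show ?thesis
    by (auto simp: ST_def swap_first_in_multiset_strings length_multiset_strings)
qed

interpretation ST: pair_graph "ST l k" for l k
  by (rule pair_graph_ST)

lemma parcs_ST_nth_0_neq: "(v, w) \<in> parcs (ST l k) \<Longrightarrow> w ! 0 \<noteq> v ! 0"
  by (auto simp: parcs_ST_iff nth_0_swap_first)

lemma common_neighbour_ST_unique:
  assumes "(v, u) \<in> parcs (ST l k)" "(v, u') \<in> parcs (ST l k)"
    and "(w, u) \<in> parcs (ST l k)" "(w, u') \<in> parcs (ST l k)"
    and "u ! 0 = u' ! 0" "u \<noteq> u'"
  shows "w = v"
proof -
  obtain j where j: "j < length v" "v ! j \<noteq> v ! 0" "u = swap_first j v"
    using assms(1) by (auto simp: parcs_ST_iff)
  obtain m where m: "m < length v" "u' = swap_first m v"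
    using assms(2) by (auto simp: parcs_ST_iff)
  obtain p where p: "p < length v" "w = swap_first p (swap_first j v)"
    using ST.arcs_symmetric[OF assms(3)] j by (auto simp: parcs_ST_iff)
  obtain q where q: "q < length v" "w = swap_first q (swap_first m v)"
    using ST.arcs_symmetric[OF assms(4)] m by (auto simp: parcs_ST_iff)
  have "v ! j = v ! m" "j \<noteq> m"
    using \<open>u ! 0 = u' ! 0\<close> \<open>u \<noteq> u'\<close> j m by (auto simp: nth_0_swap_first)
  then have "p = j"
    using j m p q by (intro swap_first_swap_first_eqD[of p j v q m]) auto
  with p j show "w = v" by (simp add: swap_first_swap_first)
qed

lemma first_entry_set_subset: "first_entry_set l k i \<subseteq> pverts (ST l k)"
  by (auto simp: first_entry_set_def)

lemma independent_set_first_entry_set: "independent_set (ST l k) (first_entry_set l k i)"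
  by (auto simp: independent_set_def first_entry_set_def dest: parcs_ST_nth_0_neq)

lemma D_set_first_entry_set:
  assumes "v \<in> multiset_strings l k" and "v ! 0 \<noteq> i"
  shows "D_set (ST l k) (first_entry_set l k i) v = (\<lambda>j. swap_first j v) ` positions i v"
  using assms
  by (auto simp: D_set_def first_entry_set_def positions_def pverts_ST parcs_ST_iff
      nth_0_swap_first swap_first_in_multiset_strings length_multiset_strings)

lemma card_D_set_first_entry_set:
  assumes v: "v \<in> multiset_strings l k" "v ! 0 \<noteq> i" and "i < k"
  shows "card (D_set (ST l k) (first_entry_set l k i) v) = l"
proof -
  have "positions i v \<subseteq> {j. j < length v \<and> v ! j \<noteq> v ! 0}"
    using v by (auto simp: positions_def)
  then have "inj_on (\<lambda>j. swap_first j v) (positions i v)"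
    by (rule inj_on_subset[OF inj_on_swap_first])
  then have "card (D_set (ST l k) (first_entry_set l k i) v) = count_list v i"
    by (simp add: D_set_first_entry_set[OF v] card_image card_positions)
  also have "\<dots> = l" using v \<open>i < k\<close> by (simp add: multiset_strings_def)
  finally show ?thesis .
qed

theorem theorem2:
  fixes k l i :: nat
  assumes "k \<ge> 1" and "l \<ge> 1" and "(k, l) \<noteq> (2, 1)" and "i < k"
  shows "E_set l (ST l k) (first_entry_set l k i) \<and>
    (\<forall>v\<in>pverts (ST l k) - first_entry_set l k i.
       independent_set (ST l k) (D_set (ST l k) (first_entry_set l k i) v))"
proof (intro conjI ballI)
  show "E_set l (ST l k) (first_entry_set l k i)"
  proof (rule E_setI[OF first_entry_set_subset])
    fix v assume "v \<in> pverts (ST l k) - first_entry_set l k i"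
    then show "card (D_set (ST l k) (first_entry_set l k i) v) = l"
      using \<open>i < k\<close> by (intro card_D_set_first_entry_set) (auto simp: first_entry_set_def pverts_ST)
  next
    fix u u' v w
    assume "u \<in> first_entry_set l k i" "u' \<in> first_entry_set l k i" "u \<noteq> u'"
      and "(v, u) \<in> parcs (ST l k)" "(v, u') \<in> parcs (ST l k)"
      and "(w, u) \<in> parcs (ST l k)" "(w, u') \<in> parcs (ST l k)"
    then show "w = v"
      by (intro common_neighbour_ST_unique[of v u l k u' w]) (auto simp: first_entry_set_def)
  qed
next
  show "independent_set (ST l k) (D_set (ST l k) (first_entry_set l k i) v)" for v
    by (rule independent_set_subset[OF independent_set_first_entry_set D_set_subset])
qed

end
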